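(* Let $\ell_1=\ell_2=2$, $\varepsilon=0.25$ and let $\alpha\in(0,1)$ be fixed. For each $n$ let $d=n\times r_n$ (a positive integer), where $r_n$ is an arbitrary positive sequence that increases to infinity as $n\to\infty$. Then, with the statistics $\chi^2$ and $G$ computed from $n$ i.i.d. observations of $(X,Y,Z)$ drawn from $p$, $$\lim_{n\to\infty}\inf_{p\in\mathcal P_1(\varepsilon)}\mathbb P_p(\chi^2>q_{1-\alpha,d})=0\quad\text{and}\quad\lim_{n\to\infty}\inf_{p\in\mathcal P_1(\varepsilon)}\mathbb P_p(G>q_{1-\alpha,d})=0,$$ where $q_{1-\alpha,d}$ denotes the $1-\alpha$ quantile of the $\chi^2$ distribution with $d$ degrees of freedom.
   Context: $[a]=\{1,\ldots,a\}$ and $\mathbf 1(\cdot)$ is an indicator. $\mathcal P$ is the set of probability distributions of $(X,Y,Z)$ on $[\ell_1]\times[\ell_2]\times[d]$; $\mathcal P_0\subset\mathcal P$ is the subset for which $X$ and $Y$ are conditionally independent given $Z$; $\mathcal P_1(\varepsilon)=\{p\in\mathcal P:\inf_{q\in\mathcal P_0}\|p-q\|_1\ge\varepsilon\}$, where $\|\cdot\|_1$ is the $L_1$ distance between probability mass functions (these sets depend on $n$ through $d$). Given i.i.d. $(X_i,Y_i,Z_i)$, $i=1,\ldots,n$, from $p$, let $o_{qrs}=\sum_{i=1}^n\mathbf 1(X_i=q)\mathbf 1(Y_i=r)\mathbf 1(Z_i=s)$, $o_{q+s}=\sum_{r\in[\ell_2]}o_{qrs}$, $o_{+rs}=\sum_{q\in[\ell_1]}o_{qrs}$,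 $o_{++s}=\sum_{q\in[\ell_1],r\in[\ell_2]}o_{qrs}$, and $e_{qrs}=o_{q+s}o_{+rs}/o_{++s}$. The test statistics are $$\chi^2=\sum_{q\in[\ell_1],r\in[\ell_2],s\in[d]}\frac{(o_{qrs}-e_{qrs})^2}{e_{qrs}},\qquad G=2\sum_{q\in[\ell_1],r\in[\ell_2],s\in[d]}o_{qrs}\log\Big(\frac{o_{qrs}}{e_{qrs}}\Big).$$ Conventions: terms with $o_{++s}=0$ or $e_{qrs}=0$ (in which case $o_{qrs}=0$) are taken to be $0$, and $0\log 0=0$. *)

theory Defs
  imports "HOL-Probability.Probability"
begin

text \<open>An observation is a triple \<open>(X, Y, Z)\<close>.\<close>

type_synonym obs = "nat \<times> nat \<times> nat"

abbreviation X_of :: "obs \<Rightarrow> nat" where "X_of w \<equiv> fst w"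
abbreviation Y_of :: "obs \<Rightarrow> nat" where "Y_of w \<equiv> fst (snd w)"
abbreviation Z_of :: "obs \<Rightarrow> nat" where "Z_of w \<equiv> snd (snd w)"

definition cells :: "nat \<Rightarrow> nat \<Rightarrow> nat \<Rightarrow> obs set" where
  "cells l1 l2 d = {1..l1} \<times> {1..l2} \<times> {1..d}"

definition distributions :: "nat \<Rightarrow> nat \<Rightarrow> nat \<Rightarrow> obs pmf set" where
  "distributions l1 l2 d = {p. set_pmf p \<subseteq> cells l1 l2 d}"

definition cond_indep :: "nat \<Rightarrow> nat \<Rightarrow> nat \<Rightarrow> obs pmf \<Rightarrow> bool" where
  "cond_indep l1 l2 d p \<longleftrightarrow>
     (\<forall>x\<in>{1..l1}. \<forall>y\<in>{1..l2}. \<forall>z\<in>{1..d}. \<P>(w in measure_pmf p. Z_of w = z) > 0 \<longrightarrow>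
        \<P>(w in measure_pmf p. X_of w = x \<and> Y_of w = y \<bar> Z_of w = z) =
        \<P>(w in measure_pmf p. X_of w = x \<bar> Z_of w = z) *
        \<P>(w in measure_pmf p. Y_of w = y \<bar> Z_of w = z))"

definition null_distributions :: "nat \<Rightarrow> nat \<Rightarrow> nat \<Rightarrow> obs pmf set" where
  "null_distributions l1 l2 d = {p \<in> distributions l1 l2 d. cond_indep l1 l2 d p}"

definition L1_dist :: "nat \<Rightarrow> nat \<Rightarrow> nat \<Rightarrow> obs pmf \<Rightarrow> obs pmf \<Rightarrow> real" where
  "L1_dist l1 l2 d p q = (\<Sum>w\<in>cells l1 l2 d. \<bar>pmf p w - pmf q w\<bar>)"

definition alt_distributions :: "nat \<Rightarrow> nat \<Rightarrow> nat \<Rightarrow> real \<Rightarrow> obs pmf set" where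
  "alt_distributions l1 l2 d \<epsilon> =
     {p \<in> distributions l1 l2 d. (INF q\<in>null_distributions l1 l2 d. L1_dist l1 l2 d p q) \<ge> \<epsilon>}"

text \<open>
  The law of \<open>n\<close> i.i.d. observations from \<open>p\<close>; the sample is a function on \<open>{1..n}\<close>,
  extended by a dummy value outside.
\<close>

definition iid_sample :: "nat \<Rightarrow> obs pmf \<Rightarrow> (nat \<Rightarrow> obs) pmf" where
  "iid_sample n p = Pi_pmf {1..n} undefined (\<lambda>_. p)"

definition obs_count :: "nat \<Rightarrow> (nat \<Rightarrow> obs) \<Rightarrow> nat \<Rightarrow> nat \<Rightarrow> nat \<Rightarrow> real" where
  "obs_count n S q r s =
     (\<Sum>i=1..n. of_bool (X_of (S i) = q) * of_bool (Y_of (S i) = r) * of_bool (Z_of (S i) = s))"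

text \<open>The marginal counts \<open>o\<^bsub>q+s\<^esub>\<close>, \<open>o\<^bsub>+rs\<^esub>\<close> and \<open>o\<^bsub>++s\<^esub>\<close>.\<close>

definition count_XZ :: "nat \<Rightarrow> nat \<Rightarrow> (nat \<Rightarrow> obs) \<Rightarrow> nat \<Rightarrow> nat \<Rightarrow> real" where
  "count_XZ l2 n S q s = (\<Sum>r=1..l2. obs_count n S q r s)"

definition count_YZ :: "nat \<Rightarrow> nat \<Rightarrow> (nat \<Rightarrow> obs) \<Rightarrow> nat \<Rightarrow> nat \<Rightarrow> real" where
  "count_YZ l1 n S r s = (\<Sum>q=1..l1. obs_count n S q r s)"

definition count_Z :: "nat \<Rightarrow> nat \<Rightarrow> nat \<Rightarrow> (nat \<Rightarrow> obs) \<Rightarrow> nat \<Rightarrow> real" where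
  "count_Z l1 l2 n S s = (\<Sum>q=1..l1. \<Sum>r=1..l2. obs_count n S q r s)"

definition exp_count ::
  "nat \<Rightarrow> nat \<Rightarrow> nat \<Rightarrow> (nat \<Rightarrow> obs) \<Rightarrow> nat \<Rightarrow> nat \<Rightarrow> nat \<Rightarrow> real" where
  "exp_count l1 l2 n S q r s = count_XZ l2 n S q s * count_YZ l1 n S r s / count_Z l1 l2 n S s"

text \<open>
  Because \<open>x / 0 = 0\<close>, the expected count is \<open>0\<close> whenever \<open>o\<^bsub>++s\<^esub> = 0\<close>, and the terms of both
  statistics with expected count \<open>0\<close> (hence observed count \<open>0\<close>) vanish, as do the terms of
  \<open>G\<close> with observed count \<open>0\<close>.  These are exactly the usual conventions for empty cells.
\<close>

definition chi2_stat :: "nat \<Rightarrow> nat \<Rightarrow> nat \<Rightarrow> nat \<Rightarrow> (nat \<Rightarrow> obs) \<Rightarrow> real" where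
  "chi2_stat l1 l2 d n S =
     (\<Sum>(q, r, s)\<in>cells l1 l2 d.
        (obs_count n S q r s - exp_count l1 l2 n S q r s)\<^sup>2 / exp_count l1 l2 n S q r s)"

definition G_stat :: "nat \<Rightarrow> nat \<Rightarrow> nat \<Rightarrow> nat \<Rightarrow> (nat \<Rightarrow> obs) \<Rightarrow> real" where
  "G_stat l1 l2 d n S =
     2 * (\<Sum>(q, r, s)\<in>cells l1 l2 d.
        obs_count n S q r s * ln (obs_count n S q r s / exp_count l1 l2 n S q r s))"

text \<open>
  The chi-square distribution with \<open>d\<close> degrees of freedom: the law of the sum of the squares of
  \<open>d\<close> independent standard normal variables.
\<close>

definition chi_square_distribution :: "nat \<Rightarrow> real measure" where
  "chi_square_distribution d =
     distr (Pi\<^sub>M {..<d} (\<lambda>_. density lborel std_normal_density)) borel (\<lambda>x. \<Sum>i<d. (x i)\<^sup>2)"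

definition quantile :: "real measure \<Rightarrow> real \<Rightarrow> real" where
  "quantile M u = Inf {x. u \<le> cdf M x}"

end

theory Submission
  imports Defs
begin

text \<open>
  Both statistics are bounded by a multiple of the sample size, for every sample whatsoever: a
  stratum with \<open>N\<close> observations contributes at most a constant times \<open>N\<close>, however many empty
  strata there are (\<open>chi2_stat_le\<close>, \<open>G_stat_le\<close>). The \<open>1 - \<alpha>\<close> quantile of the chi-square
  distribution, on the other hand, grows linearly in the degrees of freedom \<open>d\<close>, because the
  distribution concentrates around its mean \<open>d\<close>; the Chernoff bound
  \<open>cdf_chi_square_distribution_le\<close> makes it at least \<open>d / 2\<close> for large \<open>d\<close>
  (\<open>eventually_half_le_quantile_chi_square\<close>). When \<open>d / n\<close> tends to infinity, the critical value
  therefore exceeds the largest possible value of the statistic from some \<open>n\<close> on, and the test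
  rejects with probability exactly zero, under every distribution.

  The infimum of the rejection probabilities is then the infimum of a constant zero function,
  which is zero as soon as there is an alternative at all. One is given by a single stratum in
  which \<open>X = Y\<close> is a fair coin flip (\<open>diagonal_pmf_far\<close>): conditional independence
  forces the determinant of each stratum to vanish, and small \<open>L\<^sub>1\<close> perturbations of the
  diagonal table keep it positive.
\<close>

section \<open>Bounds on the statistics\<close>

lemma obs_count_nonneg: "0 \<le> obs_count n S q r s"
  unfolding obs_count_def by (intro sum_nonneg) auto

lemma count_XZ_le_count_Z:
  assumes "q \<in> {1..l1}"
  shows "count_XZ l2 n S q s \<le> count_Z l1 l2 n S s"
  unfolding count_XZ_def count_Z_def using assms
  by (intro member_le_sum[where f = "\<lambda>q. \<Sum>r=1..l2. obs_count n S q r s"])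
    (auto intro!: sum_nonneg obs_count_nonneg)

lemma count_YZ_le_count_Z:
  assumes "r \<in> {1..l2}"
  shows "count_YZ l1 n S r s \<le> count_Z l1 l2 n S s"
  unfolding count_YZ_def count_Z_def using assms
  by (intro sum_mono member_le_sum) (auto intro!: obs_count_nonneg)

lemma obs_count_le_count_XZ:
  assumes "r \<in> {1..l2}"
  shows "obs_count n S q r s \<le> count_XZ l2 n S q s"
  unfolding count_XZ_def using assms by (intro member_le_sum) (auto intro!: obs_count_nonneg)

lemma obs_count_le_count_YZ:
  assumes "q \<in> {1..l1}"
  shows "obs_count n S q r s \<le> count_YZ l1 n S r s"
  unfolding count_YZ_def using assms
  by (intro member_le_sum[where f = "\<lambda>q. obs_count n S q r s"])
    (auto intro!: obs_count_nonneg)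

text \<open>
  This is only an inequality because a sample may contain observations outside the cells.
\<close>

lemma sum_count_Z_le: "(\<Sum>s=1..d. count_Z l1 l2 n S s) \<le> real n"
proof -
  have "(\<Sum>s=1..d. count_Z l1 l2 n S s) =
      (\<Sum>i=1..n. (\<Sum>q=1..l1. of_bool (X_of (S i) = q)) *
        (\<Sum>r=1..l2. of_bool (Y_of (S i) = r)) * (\<Sum>s=1..d. of_bool (Z_of (S i) = s)))"
    unfolding count_Z_def obs_count_def sum_distrib_left sum_distrib_right
    by (subst sum.swap[where A = "{1..n}"], rule sum.cong[OF refl],
        subst sum.swap[where A = "{1..n}"], subst sum.swap, rule sum.cong[OF refl],
        subst sum.swap, rule sum.cong[OF refl], rule refl)
  also have "\<dots> \<le> (\<Sum>i=1..n. 1)"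
  proof (rule sum_mono)
    fix i
    have indicator_sum: "(\<Sum>k=1..m. of_bool (x = k)) = (of_bool (x \<in> {1..m}) :: real)"
      for x m :: nat
      by (simp add: of_bool_def)
    show "(\<Sum>q=1..l1. of_bool (X_of (S i) = q)) * (\<Sum>r=1..l2. of_bool (Y_of (S i) = r))
        * (\<Sum>s=1..d. of_bool (Z_of (S i) = s)) \<le> (1::real)"
      unfolding indicator_sum by simp
  qed
  finally show ?thesis by simp
qed

text \<open>
  Reduces a bound on a statistic to a bound on its summand in one cell. Charging every cell of a
  stratum with the full stratum count loses only the factor \<open>l1 * l2\<close>, which does not grow with
  the number of strata.
\<close>

lemma sum_cells_le:
  fixes t :: "nat \<Rightarrow> nat \<Rightarrow> nat \<Rightarrow> real"
  assumes "\<And>q r s. q \<in> {1..l1} \<Longrightarrow> r \<in> {1..l2} \<Longrightarrow> t q r s \<le> C * count_Z l1 l2 n S s"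
    and "0 \<le> C"
  shows "(\<Sum>(q, r, s)\<in>cells l1 l2 d. t q r s) \<le> C * real (l1 * l2) * real n"
proof -
  have "(\<Sum>(q, r, s)\<in>cells l1 l2 d. t q r s) = (\<Sum>q=1..l1. \<Sum>r=1..l2. \<Sum>s=1..d. t q r s)"
    unfolding cells_def by (simp add: sum.cartesian_product)
  also have "\<dots> \<le> (\<Sum>q=1..l1. \<Sum>r=1..l2. \<Sum>s=1..d. C * count_Z l1 l2 n S s)"
    by (intro sum_mono assms(1)) auto
  also have "\<dots> = C * real (l1 * l2) * (\<Sum>s=1..d. count_Z l1 l2 n S s)"
    by (simp add: ac_simps flip: sum_distrib_left)
  also have "\<dots> \<le> C * real (l1 * l2) * real n"
    using assms(2) by (intro mult_left_mono sum_count_Z_le) simp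
  finally show ?thesis .
qed

text \<open>
  The estimate behind both statistics. With row and column margins \<open>R\<close> and \<open>C\<close> and stratum count
  \<open>N\<close>, the left-hand side is \<open>k\<^sup>2 N / (R C)\<close>, and the cell count \<open>k\<close> exceeds neither margin.
\<close>

lemma obs_count_sq_div_exp_count_le:
  assumes "q \<in> {1..l1}" "r \<in> {1..l2}"
  shows "(obs_count n S q r s)\<^sup>2 / exp_count l1 l2 n S q r s \<le> count_Z l1 l2 n S s"
proof -
  define k R C N where "k = obs_count n S q r s" and "R = count_XZ l2 n S q s"
    and "C = count_YZ l1 n S r s" and "N = count_Z l1 l2 n S s"
  have "0 \<le> k" "k \<le> R" "k \<le> C" "R \<le> N"
    unfolding k_def R_def C_def N_def
    by (rule obs_count_nonneg obs_count_le_count_XZ obs_count_le_count_YZ count_XZ_le_count_Z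
        assms)+
  then have "k\<^sup>2 \<le> R * C" "0 \<le> R" "0 \<le> C" "0 \<le> N"
    by (auto simp: power2_eq_square intro: mult_mono)
  then have "k\<^sup>2 * N \<le> N * (R * C)"
    by (simp add: mult.commute mult_left_mono)
  then have "k\<^sup>2 / (R * C / N) \<le> N"
    using \<open>0 \<le> R\<close> \<open>0 \<le> C\<close> \<open>0 \<le> N\<close>
    by (cases "R * C = 0") (auto simp: divide_le_eq mult_less_0_iff)
  then show ?thesis
    by (simp add: exp_count_def k_def R_def C_def N_def)
qed

lemma exp_count_nonneg: "0 \<le> exp_count l1 l2 n S q r s"
  unfolding exp_count_def count_XZ_def count_YZ_def count_Z_def
  by (intro divide_nonneg_nonneg mult_nonneg_nonneg sum_nonneg obs_count_nonneg)

lemma exp_count_le_count_Z: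
  assumes "q \<in> {1..l1}" "r \<in> {1..l2}"
  shows "exp_count l1 l2 n S q r s \<le> count_Z l1 l2 n S s"
proof -
  define R C N where "R = count_XZ l2 n S q s"
    and "C = count_YZ l1 n S r s" and "N = count_Z l1 l2 n S s"
  have "0 \<le> R" "0 \<le> C" "R \<le> N" "C \<le> N"
    using assms count_XZ_le_count_Z count_YZ_le_count_Z
    by (auto simp: R_def C_def N_def count_XZ_def count_YZ_def intro!: sum_nonneg obs_count_nonneg)
  then have "R * C / N \<le> N"
    by (cases "N = 0") (auto simp: divide_le_eq intro: mult_mono)
  then show ?thesis
    by (simp add: exp_count_def R_def C_def N_def)
qed

lemma chi2_stat_le: "chi2_stat l1 l2 d n S \<le> 2 * real (l1 * l2) * real n"
  unfolding chi2_stat_def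
proof (rule sum_cells_le)
  fix q r s
  assume qr: "q \<in> {1..l1}" "r \<in> {1..l2}"
  define k e where "k = obs_count n S q r s" and "e = exp_count l1 l2 n S q r s"
  have "0 \<le> k" "0 \<le> e"
    by (simp_all add: k_def e_def obs_count_nonneg exp_count_nonneg)
  then have "(k - e)\<^sup>2 \<le> k\<^sup>2 + e\<^sup>2"
    by (simp add: power2_diff)
  then have "(k - e)\<^sup>2 / e \<le> (k\<^sup>2 + e\<^sup>2) / e"
    using \<open>0 \<le> e\<close> by (rule divide_right_mono)
  also have "\<dots> = k\<^sup>2 / e + e"
    by (simp add: add_divide_distrib power2_eq_square)
  also have "\<dots> \<le> 2 * count_Z l1 l2 n S s"
    using obs_count_sq_div_exp_count_le[OF qr] exp_count_le_count_Z[OF qr]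
    unfolding k_def e_def by (smt (verit))
  finally show "(obs_count n S q r s - exp_count l1 l2 n S q r s)\<^sup>2 / exp_count l1 l2 n S q r s
      \<le> 2 * count_Z l1 l2 n S s"
    by (simp add: k_def e_def)
qed simp

text \<open>
  The logarithm is at most its argument, so each summand \<open>k ln (k / e)\<close> is again controlled by
  \<open>k\<^sup>2 / e\<close>.
\<close>

lemma G_stat_le: "G_stat l1 l2 d n S \<le> 2 * real (l1 * l2) * real n"
proof -
  have "(\<Sum>(q, r, s)\<in>cells l1 l2 d.
      obs_count n S q r s * ln (obs_count n S q r s / exp_count l1 l2 n S q r s))
    \<le> 1 * real (l1 * l2) * real n"
  proof (rule sum_cells_le)
    fix q r s
    assume qr: "q \<in> {1..l1}" "r \<in> {1..l2}"
    define k e where "k = obs_count n S q r s" and "e = exp_count l1 l2 n S q r s"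
    have "0 \<le> k" "0 \<le> e"
      by (simp_all add: k_def e_def obs_count_nonneg exp_count_nonneg)
    \<comment> \<open>In the degenerate case the bound on the logarithm rests on the convention \<open>ln 0 = 0\<close>.\<close>
    then have "0 < k / e \<or> k / e = 0"
      using divide_nonneg_nonneg[of k e] by linarith
    then have "ln (k / e) \<le> k / e"
      using ln_bound by (elim disjE) (blast, simp only: ln_0)
    then have "k * ln (k / e) \<le> k * (k / e)"
      using \<open>0 \<le> k\<close> by (rule mult_left_mono)
    also have "\<dots> = k\<^sup>2 / e"
      by (simp add: power2_eq_square)
    also have "\<dots> \<le> 1 * count_Z l1 l2 n S s"
      using obs_count_sq_div_exp_count_le[OF qr] by (simp add: k_def e_def)
    finally show "obs_count n S q r s * ln (obs_count n S q r s / exp_count l1 l2 n S q r s)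
        \<le> 1 * count_Z l1 l2 n S s"
      by (simp add: k_def e_def)
  qed simp
  then show ?thesis
    by (simp add: G_stat_def)
qed

section \<open>Quantiles of the chi-square distribution\<close>

abbreviation std_normal :: "real measure" where
  "std_normal \<equiv> density lborel std_normal_density"

text \<open>
  The value at \<open>-1/2\<close> of the moment generating function of a squared standard normal variable:
  the exponential factor turns the standard normal density into a multiple of the normal density
  with variance \<open>1/2\<close>.
\<close>

lemma nn_integral_std_normal_exp:
  "(\<integral>\<^sup>+x. ennreal (exp (- x\<^sup>2 / 2)) \<partial>std_normal) = ennreal (1 / sqrt 2)"
proof -
  have density: "std_normal_density x * exp (- x\<^sup>2 / 2) = 1 / sqrt 2 * normal_density 0 (1 / sqrt 2) x"
    for x :: real
  proof -
    have variance: "(1 / sqrt 2)\<^sup>2 = (1 / 2 :: real)"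
      by (simp add: power_divide)
    have "exp (- x\<^sup>2 / 2) * exp (- x\<^sup>2 / 2) = exp (- x\<^sup>2)"
      by (simp flip: exp_add)
    then show ?thesis
      unfolding normal_density_def variance by (simp add: real_sqrt_mult)
  qed
  have prob: "prob_space (density lborel (normal_density 0 (1 / sqrt 2)))"
    by (rule prob_space_normal_density) simp
  have "(\<integral>\<^sup>+x. ennreal (exp (- x\<^sup>2 / 2)) \<partial>std_normal) =
      (\<integral>\<^sup>+x. ennreal (std_normal_density x * exp (- x\<^sup>2 / 2)) \<partial>lborel)"
    by (subst nn_integral_density) (auto simp: ennreal_mult)
  also have "\<dots> = (\<integral>\<^sup>+x. ennreal (1 / sqrt 2) * ennreal (normal_density 0 (1 / sqrt 2) x) \<partial>lborel)"
    unfolding density by (subst ennreal_mult) auto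
  also have "\<dots> = ennreal (1 / sqrt 2) * (\<integral>\<^sup>+x. ennreal (normal_density 0 (1 / sqrt 2) x) \<partial>lborel)"
    by (rule nn_integral_cmult) simp
  also have "(\<integral>\<^sup>+x. ennreal (normal_density 0 (1 / sqrt 2) x) \<partial>lborel) = 1"
    using prob_space.emeasure_space_1[OF prob] by (simp add: emeasure_density)
  finally show ?thesis by simp
qed

lemma prob_space_std_normal_power: "prob_space (Pi\<^sub>M {..<d::nat} (\<lambda>_. std_normal))"
  by (intro prob_space_PiM prob_space_normal_density) simp

lemma prob_space_chi_square_distribution: "prob_space (chi_square_distribution d)"
  unfolding chi_square_distribution_def
  by (intro prob_space.prob_space_distr prob_space_std_normal_power) measurable

text \<open>
  Chernoff's bound for the lower tail: the indicator of \<open>Q \<le> t\<close> is dominated by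
  \<open>exp ((t - Q) / 2)\<close>, and the expectation of \<open>exp (- Q / 2)\<close> factorizes over the independent
  coordinates.
\<close>

lemma cdf_chi_square_distribution_le:
  "cdf (chi_square_distribution d) t \<le> exp (t / 2) * (1 / sqrt 2) ^ d"
proof -
  let ?P = "Pi\<^sub>M {..<d} (\<lambda>_. std_normal)"
  interpret P: prob_space ?P by (rule prob_space_std_normal_power)
  interpret product_sigma_finite "\<lambda>_::nat. std_normal"
    by (simp add: product_sigma_finite_def prob_space_imp_sigma_finite prob_space_normal_density)
  let ?A = "(\<lambda>x. \<Sum>i<d. (x i)\<^sup>2) -` {..t} \<inter> space ?P"
  have "ennreal (cdf (chi_square_distribution d) t) = emeasure ?P ?A"
    unfolding cdf_def chi_square_distribution_def
    by (subst measure_distr) (auto simp: P.emeasure_eq_measure)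
  also have "\<dots> = (\<integral>\<^sup>+x. indicator ?A x \<partial>?P)"
    by (subst nn_integral_indicator) measurable
  also have "\<dots> \<le> (\<integral>\<^sup>+x. ennreal (exp (t / 2)) * (\<Prod>i<d. ennreal (exp (- (x i)\<^sup>2 / 2))) \<partial>?P)"
  proof (rule nn_integral_mono)
    fix x
    have "indicator ?A x \<le> exp ((t - (\<Sum>i<d. (x i)\<^sup>2)) / 2)"
      by (auto simp: indicator_def)
    also have "\<dots> = exp (t / 2) * (\<Prod>i<d. exp (- (x i)\<^sup>2 / 2))"
      by (simp add: diff_divide_distrib sum_divide_distrib sum_negf
          flip: exp_sum exp_add)
    finally show "indicator ?A x \<le> ennreal (exp (t / 2)) * (\<Prod>i<d. ennreal (exp (- (x i)\<^sup>2 / 2)))"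
      by (subst prod_ennreal, simp, subst ennreal_mult[symmetric])
        (auto simp: prod_nonneg ennreal_leI simp flip: ennreal_indicator)
  qed
  also have "\<dots> = ennreal (exp (t / 2)) * (\<integral>\<^sup>+x. (\<Prod>i<d. ennreal (exp (- (x i)\<^sup>2 / 2))) \<partial>?P)"
    by (rule nn_integral_cmult) measurable
  also have "(\<integral>\<^sup>+x. (\<Prod>i<d. ennreal (exp (- (x i)\<^sup>2 / 2))) \<partial>?P) = (\<Prod>i<d. ennreal (1 / sqrt 2))"
    using nn_integral_std_normal_exp by (subst product_nn_integral_prod) auto
  finally have "ennreal (cdf (chi_square_distribution d) t)
      \<le> ennreal (exp (t / 2) * (1 / sqrt 2) ^ d)"
    by (simp add: ennreal_power ennreal_mult)
  then show ?thesis
    by (subst (asm) ennreal_le_iff) auto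
qed

text \<open>
  The hypothesis \<open>u < 1\<close> ensures that some point reaches the level \<open>u\<close>; otherwise the quantile
  would be the infimum of a possibly empty set of reals.
\<close>

lemma le_quantile:
  assumes "prob_space M" "sets M = sets borel" "u < 1" "cdf M t < u"
  shows "t \<le> quantile M u"
proof -
  interpret prob_space M by fact
  interpret real_distribution M
    using assms(2) sets_eq_imp_space_eq[OF assms(2)] by unfold_locales auto
  have "eventually (\<lambda>x. u < cdf M x) at_top"
    using cdf_lim_at_top_prob assms(3) by (rule order_tendstoD)
  then obtain x where "u < cdf M x"
    by (auto simp: eventually_at_top_linorder)
  then have "{x. u \<le> cdf M x} \<noteq> {}"
    by (auto intro: less_imp_le)
  moreover have "t \<le> x" if "u \<le> cdf M x" for x
    using that assms(4) cdf_nondecreasing[of x t] by linarith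
  ultimately show ?thesis
    unfolding quantile_def by (intro cInf_greatest) auto
qed

text \<open>
  At \<open>t = d / 2\<close> Chernoff's bound is the \<open>d\<close>-th power of \<open>exp (1 / 4) / sqrt 2\<close>, which is less
  than one because \<open>exp 1 < 4\<close>.
\<close>

lemma eventually_half_le_quantile_chi_square:
  assumes "0 < u" "u < 1"
  shows "\<forall>\<^sub>F d in sequentially. real d / 2 \<le> quantile (chi_square_distribution d) u"
proof -
  define b :: real where "b = exp (1 / 4) / sqrt 2"
  have "exp (1 / 4 :: real) ^ 4 = exp 1"
    by (simp flip: exp_of_nat_mult)
  also have "\<dots> < sqrt 2 ^ 4"
    using exp_le by (simp add: power4_eq_xxxx mult.assoc)
  finally have "exp (1 / 4) < sqrt 2"
    by (rule power_less_imp_less_base) simp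
  then have "0 < b" "b < 1"
    by (simp_all add: b_def)
  then have "(\<lambda>d. b ^ d) \<longlonglongrightarrow> 0"
    by (intro LIMSEQ_realpow_zero) auto
  then have "\<forall>\<^sub>F d in sequentially. b ^ d < u"
    using assms(1) by (rule order_tendstoD)
  then show ?thesis
  proof eventually_elim
    case (elim d)
    have "cdf (chi_square_distribution d) (real d / 2) \<le> exp (real d / 2 / 2) * (1 / sqrt 2) ^ d"
      by (rule cdf_chi_square_distribution_le)
    also have "\<dots> = b ^ d"
      by (simp add: b_def power_divide flip: exp_of_nat_mult)
    finally have "cdf (chi_square_distribution d) (real d / 2) < u"
      using elim by simp
    then show ?case
      using assms(2)
      by (intro le_quantile prob_space_chi_square_distribution) (simp_all add: chi_square_distribution_def)
  qed
qed

section \<open>A distribution far from conditional independence\<close>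

text \<open>
  Clearing denominators, conditional independence says \<open>a\<^sub>1\<^sub>1 N = (a\<^sub>1\<^sub>1 + a\<^sub>1\<^sub>2) (a\<^sub>1\<^sub>1 + a\<^sub>2\<^sub>1)\<close>
  for the total mass \<open>N\<close> of the stratum; expanding leaves the determinant. A stratum of mass zero
  has only zero entries.
\<close>

lemma cond_indep_imp_det_zero:
  assumes "set_pmf q \<subseteq> cells 2 2 d" "cond_indep 2 2 d q" "z \<in> {1..d}"
  shows "pmf q (1, 1, z) * pmf q (2, 2, z) = pmf q (1, 2, z) * pmf q (2, 1, z)"
proof -
  define a where "a x y = pmf q (x, y, z)" for x y
  have in_cells: "w \<in> cells 2 2 d" if "w \<in> set_pmf q" for w
    using assms(1) that by auto
  have two: "x \<in> {1..2} \<longleftrightarrow> x = 1 \<or> x = 2" for x :: nat by auto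
  \<comment> \<open>Turns each event into an explicit finite set of cells, up to a set of probability zero.\<close>
  have prob: "\<P>(w in measure_pmf q. Q w) = sum (pmf q) W"
    if "finite W" "\<And>w. w \<in> cells 2 2 d \<Longrightarrow> Q w \<longleftrightarrow> w \<in> W" for Q W
  proof -
    have "\<P>(w in measure_pmf q. Q w) = measure q W"
      using that(2) in_cells by (intro measure_pmf.finite_measure_eq_AE) (auto simp: AE_measure_pmf_iff)
    then show ?thesis
      using that(1) by (simp add: measure_measure_pmf_finite)
  qed
  have cell: "\<P>(w in measure_pmf q. (X_of w = x \<and> Y_of w = y) \<and> Z_of w = z) = a x y" for x y
    by (subst prob[of "{(x, y, z)}"]) (auto simp: a_def)
  have row: "\<P>(w in measure_pmf q. X_of w = x \<and> Z_of w = z) = a x 1 + a x 2" for x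
    by (subst prob[of "{(x, 1, z), (x, 2, z)}"]) (auto simp: a_def cells_def two)
  have column: "\<P>(w in measure_pmf q. Y_of w = y \<and> Z_of w = z) = a 1 y + a 2 y" for y
    by (subst prob[of "{(1, y, z), (2, y, z)}"]) (auto simp: a_def cells_def two)
  define N where "N = a 1 1 + a 1 2 + a 2 1 + a 2 2"
  have total: "\<P>(w in measure_pmf q. Z_of w = z) = N"
    by (subst prob[of "{(1, 1, z), (1, 2, z), (2, 1, z), (2, 2, z)}"])
      (auto simp: a_def cells_def two N_def)
  have nonneg: "0 \<le> a x y" for x y
    by (simp add: a_def)
  show ?thesis
  proof (cases "N = 0")
    case True
    then have "a 1 1 = 0" "a 1 2 = 0"
      using nonneg[of 1 1] nonneg[of 1 2] nonneg[of 2 1] nonneg[of 2 2] unfolding N_def by linarith+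
    then show ?thesis by (simp add: a_def)
  next
    case False
    then have "N > 0"
      using nonneg[of 1 1] nonneg[of 1 2] nonneg[of 2 1] nonneg[of 2 2] unfolding N_def by linarith
    have "1 \<in> {1..2::nat}" by simp
    from assms(2)[unfolded cond_indep_def, rule_format, OF this this assms(3)]
    have "a 1 1 / N = (a 1 1 + a 1 2) / N * ((a 1 1 + a 2 1) / N)"
      unfolding cond_prob_def total cell row column using \<open>N > 0\<close> by blast
    then have "a 1 1 * N = (a 1 1 + a 1 2) * (a 1 1 + a 2 1)"
      using \<open>N > 0\<close> by (simp add: field_simps)
    then show ?thesis
      unfolding N_def a_def by (simp add: algebra_simps)
  qed
qed

definition diagonal_pmf :: "obs pmf" where
  "diagonal_pmf = pmf_of_set {(1, 1, 1), (2, 2, 1)}"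

text \<open>
  If \<open>q\<close> were closer than \<open>1 / 4\<close>, its diagonal entries in the stratum would exceed \<open>1 / 4\<close> and
  its off-diagonal ones would stay below \<open>1 / 4\<close>, so its determinant would be positive.
\<close>

lemma diagonal_pmf_far:
  assumes "q \<in> null_distributions 2 2 d" "0 < d"
  shows "1 / 4 \<le> L1_dist 2 2 d diagonal_pmf q"
proof (rule ccontr)
  define a where "a x y = pmf q (x, y, 1)" for x y
  let ?W = "{(1, 1, 1), (2, 2, 1), (1, 2, 1), (2, 1, 1)} :: obs set"
  assume "\<not> 1 / 4 \<le> L1_dist 2 2 d diagonal_pmf q"
  moreover have "(\<Sum>w\<in>?W. \<bar>pmf diagonal_pmf w - pmf q w\<bar>) \<le> L1_dist 2 2 d diagonal_pmf q"
    unfolding L1_dist_def using assms(2)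
    by (intro sum_mono2) (auto simp: cells_def)
  moreover have "(\<Sum>w\<in>?W. \<bar>pmf diagonal_pmf w - pmf q w\<bar>) =
      \<bar>1 / 2 - a 1 1\<bar> + \<bar>1 / 2 - a 2 2\<bar> + \<bar>a 1 2\<bar> + \<bar>a 2 1\<bar>"
    by (simp add: diagonal_pmf_def a_def)
  ultimately have close: "\<bar>1 / 2 - a 1 1\<bar> + \<bar>1 / 2 - a 2 2\<bar> + \<bar>a 1 2\<bar> + \<bar>a 2 1\<bar> < 1 / 4"
    by linarith
  have "a 1 1 * a 2 2 = a 1 2 * a 2 1"
    using assms cond_indep_imp_det_zero[of q d 1]
    by (auto simp: a_def null_distributions_def distributions_def)
  moreover have "a 1 2 * a 2 1 < 1 / 4 * (1 / 4)"
  proof (rule mult_strict_mono')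
    show "0 \<le> a 1 2" "0 \<le> a 2 1"
      by (simp_all add: a_def)
    show "a 1 2 < 1 / 4" "a 2 1 < 1 / 4"
      using close by linarith+
  qed
  moreover have "1 / 4 * (1 / 4) \<le> a 1 1 * a 2 2"
    using close by (intro mult_mono) linarith+
  ultimately show False by linarith
qed

text \<open>A point mass makes all coordinates independent.\<close>

lemma null_distributions_nonempty:
  assumes "0 < l1" "0 < l2" "0 < d"
  shows "null_distributions l1 l2 d \<noteq> {}"
proof -
  have "return_pmf (1, 1, 1) \<in> null_distributions l1 l2 d"
    using assms
    by (auto simp: null_distributions_def distributions_def cells_def cond_indep_def cond_prob_def
        indicator_def)
  then show ?thesis by blast
qed

lemma alt_distributions_nonempty:
  assumes "0 < d"
  shows "alt_distributions 2 2 d 0.25 \<noteq> {}"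
proof -
  have "diagonal_pmf \<in> distributions 2 2 d"
    using assms by (auto simp: diagonal_pmf_def distributions_def cells_def)
  moreover have "0.25 \<le> (INF q\<in>null_distributions 2 2 d. L1_dist 2 2 d diagonal_pmf q)"
    using assms diagonal_pmf_far null_distributions_nonempty[of 2 2 d]
    by (intro cINF_greatest) auto
  ultimately show ?thesis
    by (auto simp: alt_distributions_def)
qed

section \<open>Vanishing power\<close>

text \<open>
  The sets \<open>\<A> n\<close> have to be nonempty because the infimum of the empty set of reals has no
  specified value.
\<close>

lemma INF_rejection_prob_tendsto_zero:
  fixes T :: "nat \<Rightarrow> (nat \<Rightarrow> obs) \<Rightarrow> real" and c :: "nat \<Rightarrow> real"
  assumes "\<forall>\<^sub>F n in sequentially. \<A> n \<noteq> {}"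
    and "\<forall>\<^sub>F n in sequentially. \<forall>S. T n S \<le> c n"
  shows "(\<lambda>n. INF p\<in>\<A> n. \<P>(S in measure_pmf (iid_sample n p). T n S > c n)) \<longlonglongrightarrow> 0"
proof (rule tendsto_eventually)
  show "\<forall>\<^sub>F n in sequentially.
      (INF p\<in>\<A> n. \<P>(S in measure_pmf (iid_sample n p). T n S > c n)) = 0"
    using assms
  proof eventually_elim
    case (elim n)
    then have "{S. c n < T n S} = {}"
      by (auto simp: not_less)
    then show ?case
      using elim(1) by simp
  qed
qed

theorem proposition2:
  fixes \<alpha> :: real and r :: "nat \<Rightarrow> real" and d :: "nat \<Rightarrow> nat"
  assumes "0 < \<alpha>" and "\<alpha> < 1"
    and "\<And>n. n \<ge> 1 \<Longrightarrow> r n > 0"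
    and "mono_on {1..} r"
    and "filterlim r at_top sequentially"
    and "\<And>n. n \<ge> 1 \<Longrightarrow> d n > 0 \<and> real (d n) = real n * r n"
  shows "(\<lambda>n. INF p\<in>alt_distributions 2 2 (d n) 0.25.
            \<P>(S in measure_pmf (iid_sample n p).
               chi2_stat 2 2 (d n) n S > quantile (chi_square_distribution (d n)) (1 - \<alpha>)))
          \<longlonglongrightarrow> 0
       \<and> (\<lambda>n. INF p\<in>alt_distributions 2 2 (d n) 0.25.
            \<P>(S in measure_pmf (iid_sample n p).
               G_stat 2 2 (d n) n S > quantile (chi_square_distribution (d n)) (1 - \<alpha>)))
          \<longlonglongrightarrow> 0"
proof -
  \<comment> \<open>For two by two tables both statistics are at most \<open>8 n\<close>, and the quantile is at least
    \<open>d / 2\<close>; they separate once \<open>d \<ge> 16 n\<close>.\<close>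
  have r_large: "\<forall>\<^sub>F n in sequentially. 16 \<le> r n"
    using assms(5) by (simp add: filterlim_at_top)
  have d_large: "\<forall>\<^sub>F n in sequentially. n \<ge> 1 \<and> 16 * real n \<le> real (d n)"
    using r_large eventually_ge_at_top[of 1]
  proof eventually_elim
    case (elim n)
    then show ?case
      using assms(6)[of n] mult_left_mono[of 16 "r n" "real n"] by simp
  qed
  have "filterlim d at_top sequentially"
    unfolding filterlim_at_top
  proof
    fix m
    show "\<forall>\<^sub>F n in sequentially. m \<le> d n"
      using d_large eventually_ge_at_top[of m] by eventually_elim linarith
  qed
  then have quantile_large: "\<forall>\<^sub>F n in sequentially.
      real (d n) / 2 \<le> quantile (chi_square_distribution (d n)) (1 - \<alpha>)"
    using eventually_half_le_quantile_chi_square[of "1 - \<alpha>"] assms(1,2)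
    by (auto intro: eventually_compose_filterlim)
  have nonempty: "\<forall>\<^sub>F n in sequentially. alt_distributions 2 2 (d n) 0.25 \<noteq> {}"
    using eventually_ge_at_top[of 1] by eventually_elim (use assms(6) alt_distributions_nonempty in blast)
  have bound: "\<forall>\<^sub>F n in sequentially. 8 * real n \<le> quantile (chi_square_distribution (d n)) (1 - \<alpha>)"
    using d_large quantile_large by eventually_elim linarith
  have "\<forall>\<^sub>F n in sequentially. \<forall>S.
      chi2_stat 2 2 (d n) n S \<le> quantile (chi_square_distribution (d n)) (1 - \<alpha>)"
    using bound
  proof eventually_elim
    case (elim n)
    then show ?case
      using chi2_stat_le[of 2 2 "d n" n] by (auto intro: order_trans)
  qed
  moreover have "\<forall>\<^sub>F n in sequentially. \<forall>S.
      G_stat 2 2 (d n) n S \<le> quantile (chi_square_distribution (d n)) (1 - \<alpha>)"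
    using bound
  proof eventually_elim
    case (elim n)
    then show ?case
      using G_stat_le[of 2 2 "d n" n] by (auto intro: order_trans)
  qed
  ultimately show ?thesis
    by (intro conjI INF_rejection_prob_tendsto_zero[OF nonempty])
qed

end
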